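(* Let $A\in\mathcal{PC}_n$ with $n>2$, and let $w\in\mathcal{V}_n$ be a positive vector. If there are $i,j\in\{1,\ldots,n\}$ with $i\neq j$ such that $w(i)$ is efficient for $A(i)$ and $w(j)$ is efficient for $A(j)$, then $w$ is efficient for $A$.
   Context: $\mathcal{PC}_n$ denotes the set of $n\times n$ reciprocal matrices, i.e. real matrices $A=[a_{ij}]$ with all entries positive and $a_{ji}=1/a_{ij}$ for all $i,j$ (so $a_{ii}=1$). $\mathcal{V}_n$ denotes the set of entrywise positive real $n$-vectors. A vector $w\in\mathcal{V}_n$ is efficient for $A\in\mathcal{PC}_n$ if, for every $v\in\mathcal{V}_n$, the inequalities $|a_{ij}-v_i/v_j|\le|a_{ij}-w_i/w_j|$ for all $i,j=1,\ldots,n$ imply that $v$ is a positive scalar multiple of $w$. $A(i)$ is the principal submatrix of $A$ obtained by deleting row and column $i$, and $w(i)$ is the vector obtained from $w$ by deleting its $i$th entry. *)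

theory Defs
  imports Complex_Main "Jordan_Normal_Form.Determinant"
begin

text \<open>Rows, columns and vector entries are numbered from 0 to n - 1.\<close>

definition reciprocal_mats :: "nat \<Rightarrow> real mat set" where
  "reciprocal_mats n = {A \<in> carrier_mat n n.
     \<forall>i<n. \<forall>j<n. A $$ (i, j) > 0 \<and> A $$ (j, i) = 1 / A $$ (i, j)}"

definition pos_vecs :: "nat \<Rightarrow> real vec set" where
  "pos_vecs n = {w \<in> carrier_vec n. \<forall>i<n. w $ i > 0}"

text \<open>Meant for \<open>A \<in> reciprocal_mats n\<close> and \<open>w \<in> pos_vecs n\<close>.\<close>

definition efficient :: "nat \<Rightarrow> real mat \<Rightarrow> real vec \<Rightarrow> bool" where
  "efficient n A w \<longleftrightarrow>
     (\<forall>v \<in> pos_vecs n.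
        (\<forall>i<n. \<forall>j<n. \<bar>A $$ (i, j) - v $ i / v $ j\<bar> \<le> \<bar>A $$ (i, j) - w $ i / w $ j\<bar>)
        \<longrightarrow> (\<exists>c>0. v = c \<cdot>\<^sub>v w))"

text \<open>The vector analogue of \<^const>\<open>mat_delete\<close>.\<close>

definition vec_delete :: "'a vec \<Rightarrow> nat \<Rightarrow> 'a vec" where
  "vec_delete v i = vec (dim_vec v - 1) (\<lambda>k. v $ (if k < i then k else Suc k))"

lemma mat_delete_reciprocal_mats:
  assumes "A \<in> reciprocal_mats n" and "i < n"
  shows "mat_delete A i i \<in> reciprocal_mats (n - 1)"
proof -
  let ?s = "\<lambda>k. if k < i then k else Suc k"
  have carr: "A \<in> carrier_mat n n"
    using assms(1) unfolding reciprocal_mats_def by blast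
  have entry: "A $$ (k, l) > 0 \<and> A $$ (l, k) = 1 / A $$ (k, l)" if "k < n" "l < n" for k l
    using assms(1) that unfolding reciprocal_mats_def by blast
  have s: "?s k < n" if "k < n - 1" for k
    using that by auto
  have del: "mat_delete A i i $$ (k, l) = A $$ (?s k, ?s l)" if "k < n - 1" "l < n - 1" for k l
    using carr that unfolding mat_delete_def by simp
  show ?thesis
    unfolding reciprocal_mats_def mem_Collect_eq
  proof (intro conjI allI impI)
    show "mat_delete A i i \<in> carrier_mat (n - 1) (n - 1)"
      by (rule mat_delete_carrier[OF carr])
  next
    fix k l assume "k < n - 1" "l < n - 1"
    then show "mat_delete A i i $$ (k, l) > 0"
      unfolding del[OF \<open>k < n - 1\<close> \<open>l < n - 1\<close>] using entry[OF s s] by blast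
  next
    fix k l assume kl: "k < n - 1" "l < n - 1"
    show "mat_delete A i i $$ (l, k) = 1 / mat_delete A i i $$ (k, l)"
      unfolding del[OF kl] del[OF kl(2) kl(1)] using entry[OF s[OF kl(1)] s[OF kl(2)]] by blast
  qed
qed

lemma vec_delete_pos_vecs:
  assumes "w \<in> pos_vecs n" and "i < n"
  shows "vec_delete w i \<in> pos_vecs (n - 1)"
  using assms by (auto simp: pos_vecs_def vec_delete_def)

end

theory Submission
  imports Defs
begin

text \<open>Let \<open>v\<close> approximate every entry of \<open>A\<close> at least as well as \<open>w\<close> does. These inequalities
  are inherited by every principal submatrix, so efficiency of \<open>w(i)\<close> for \<open>A(i)\<close> makes \<open>v\<close>
  a positive multiple of \<open>w\<close> on all indices except \<open>i\<close>, say by the factor \<open>c\<close>; likewise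
  \<open>v\<close> is a multiple of \<open>w\<close> on all indices except \<open>j\<close>, by some factor \<open>d\<close>. As \<open>n > 2\<close>, there is an
  index different from both \<open>i\<close> and \<open>j\<close>. It forces \<open>c = d\<close>, and since \<open>i \<noteq> j\<close> every index
  is covered by one of the two proportionalities.\<close>

text \<open>The inequalities in the rows and columns other than \<open>i\<close> make \<open>v(i)\<close> a competitor of
  \<open>w(i)\<close> for \<open>A(i)\<close>, so efficiency applies; the rest of the proof translates between the
  indices of a deleted vector and those of the original one.\<close>

lemma proportional_off_deleted_index:
  assumes A: "A \<in> carrier_mat n n" and w: "w \<in> carrier_vec n"
    and v: "v \<in> pos_vecs n" and i: "i < n"
    and eff: "efficient (n - 1) (mat_delete A i i) (vec_delete w i)"
    and le: "\<forall>k<n. \<forall>l<n. \<bar>A $$ (k, l) - v $ k / v $ l\<bar> \<le> \<bar>A $$ (k, l) - w $ k / w $ l\<bar>"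
  shows "\<exists>c>0. \<forall>k<n. k \<noteq> i \<longrightarrow> v $ k = c * w $ k"
proof -
  let ?s = "\<lambda>k. if k < i then k else Suc k"
  have dims: "dim_vec v = n" "dim_vec w = n"
    using v w by (auto simp: pos_vecs_def)
  have s: "?s k < n" if "k < n - 1" for k
    using that by auto
  have delA: "mat_delete A i i $$ (k, l) = A $$ (?s k, ?s l)" if "k < n - 1" "l < n - 1" for k l
    using A that unfolding mat_delete_def by simp
  have delv: "vec_delete v i $ k = v $ ?s k" and delw: "vec_delete w i $ k = w $ ?s k"
    if "k < n - 1" for k
    using that dims by (simp_all add: vec_delete_def)
  have "\<bar>mat_delete A i i $$ (k, l) - vec_delete v i $ k / vec_delete v i $ l\<bar>
      \<le> \<bar>mat_delete A i i $$ (k, l) - vec_delete w i $ k / vec_delete w i $ l\<bar>"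
    if "k < n - 1" "l < n - 1" for k l
    unfolding delA[OF that] delv[OF that(1)] delv[OF that(2)] delw[OF that(1)] delw[OF that(2)]
    by (rule le[rule_format, OF s[OF that(1)] s[OF that(2)]])
  then obtain c where c: "c > 0" "vec_delete v i = c \<cdot>\<^sub>v vec_delete w i"
    using eff vec_delete_pos_vecs[OF v i] unfolding efficient_def by blast
  have "v $ k = c * w $ k" if k: "k < n" "k \<noteq> i" for k
  proof -
    \<comment> \<open>the position of entry \<open>k\<close> after entry \<open>i\<close> has been removed\<close>
    define m where "m = (if k < i then k else k - 1)"
    have m: "m < n - 1" "?s m = k"
      using k i by (auto simp: m_def)
    have "vec_delete v i $ m = c * vec_delete w i $ m"
      using c(2) m(1) dims by (simp add: vec_delete_def)
    then show ?thesis
      unfolding delv[OF m(1)] delw[OF m(1)] m(2) .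
  qed
  with c(1) show ?thesis by blast
qed

theorem theorem8:
  fixes n :: nat and A :: "real mat" and w :: "real vec"
  assumes "n > 2"
    and "A \<in> reciprocal_mats n"
    and "w \<in> pos_vecs n"
    and "\<exists>i<n. \<exists>j<n. i \<noteq> j
           \<and> efficient (n - 1) (mat_delete A i i) (vec_delete w i)
           \<and> efficient (n - 1) (mat_delete A j j) (vec_delete w j)"
  shows "efficient n A w"
  unfolding efficient_def
proof (intro ballI impI)
  fix v
  assume v: "v \<in> pos_vecs n"
    and le: "\<forall>k<n. \<forall>l<n.
      \<bar>A $$ (k, l) - v $ k / v $ l\<bar> \<le> \<bar>A $$ (k, l) - w $ k / w $ l\<bar>"
  have A: "A \<in> carrier_mat n n" and w: "w \<in> carrier_vec n"
    using assms(2,3) by (auto simp: reciprocal_mats_def pos_vecs_def)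
  obtain i j where ij: "i < n" "j < n" "i \<noteq> j"
    and effi: "efficient (n - 1) (mat_delete A i i) (vec_delete w i)"
    and effj: "efficient (n - 1) (mat_delete A j j) (vec_delete w j)"
    using assms(4) by blast
  obtain c where c: "c > 0" "\<And>k. k < n \<Longrightarrow> k \<noteq> i \<Longrightarrow> v $ k = c * w $ k"
    using proportional_off_deleted_index[OF A w v ij(1) effi le] by blast
  obtain d where d: "\<And>k. k < n \<Longrightarrow> k \<noteq> j \<Longrightarrow> v $ k = d * w $ k"
    using proportional_off_deleted_index[OF A w v ij(2) effj le] by blast
  have "\<not> {..<n} \<subseteq> {i, j}"
    using card_mono[of "{i, j}" "{..<n}"] assms(1) ij(3) by auto
  then obtain k where k: "k < n" "k \<noteq> i" "k \<noteq> j"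
    by auto
  have "w $ k > 0"
    using assms(3) k(1) by (simp add: pos_vecs_def)
  then have "c = d"
    using c(2)[OF k(1,2)] d[OF k(1,3)] by simp
  have "v $ l = c * w $ l" if "l < n" for l
    using c(2)[OF that] d[OF that] ij(3) \<open>c = d\<close> by (cases "l = i") auto
  then have "v = c \<cdot>\<^sub>v w"
    using v w by (intro eq_vecI) (auto simp: pos_vecs_def)
  with c(1) show "\<exists>c>0. v = c \<cdot>\<^sub>v w" by blast
qed

end
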